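(* The proof system $\mathbb{IRIK}$ is sound and strongly complete with respect to the class of serial proper bi-frames. That is, for every set $\Gamma$ of formulas and every formula $\varphi$ of the language $\mathbf{IRI}$: $\Gamma\vdash_{\mathbb{IRIK}}\varphi$ if and only if $\Gamma\vDash_F\varphi$, where $F$ is the class of all serial proper bi-frames.
   Context: Language. Fix a nonempty set $\mathbf{P}$ of propositional variables. The formulas of the language $\mathbf{IRI}$ are given by $\varphi::=p\mid\neg\varphi\mid(\varphi\land\varphi)\mid I\varphi\mid I^R\varphi$ with $p\in\mathbf{P}$. Other Boolean connectives $\vee,\to,\leftrightarrow,\top,\bot$ are defined as usual. Bi-semantics. A bi-frame is a triple $\langle S,R,R^\bullet\rangle$ with $S$ a nonempty set and $R,R^\bullet$ binary relations on $S$; a bi-model $\mathcal{M}=\langle S,R,R^\bullet,V\rangle$ is a bi-frame with a valuation $V:\mathbf{P}\to\mathcal{P}(S)$. A bi-frame is proper if $R\subseteq R^\bullet$; it is serial if both $R$ and $R^\bullet$ are serial (every state has a successor). Truth at $s\in S$: $\mathcal{M},s\vDash p$ iff $s\in V(p)$; $\neg,\land$ are interpreted classically; $\mathcal{M},s\vDash I\varphi$ iff there is $t$ with $sRt$ and $\mathcal{M},t\vDash\varphi$, and there is $u$ with $sRu$ and $\mathcal{M},u\nvDash\varphi$; $\mathcal{M},s\vDash I^R\varphi$ iff $\mathcal{M},s\vDash I\varphi$ and there is $t$ with $sR^\bullet t$ and $\mathcal{M},t\nvDash I\varphi$. For a class $F$ of bi-frames, $\Gamma\vDash_F\varphi$ means: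 for every bi-model $\mathcal{M}$ based on a bi-frame in $F$ and every state $s$ of $\mathcal{M}$, if $\mathcal{M},s\vDash\gamma$ for all $\gamma\in\Gamma$, then $\mathcal{M},s\vDash\varphi$. Proof system $\mathbb{IRIK}$. Axioms: all instances of propositional tautologies; $I\varphi\leftrightarrow I\neg\varphi$; $I^R\varphi\leftrightarrow I^R\neg\varphi$; $I(\varphi\land\psi)\to(I\varphi\vee I\psi)$; $I(\varphi\vee\psi)\land I(\neg\varphi\vee\chi)\to I\varphi$; $I^R\varphi\to I\varphi$; $I\varphi\land I(I\varphi\vee\chi)\to I^R\varphi$. Rules: modus ponens; from $\varphi$ infer $\neg I\varphi$; from $\varphi\leftrightarrow\psi$ infer $I\varphi\leftrightarrow I\psi$; from $\varphi\leftrightarrow\psi$ infer $I^R\varphi\leftrightarrow I^R\psi$; for every $n\in\mathbb{N}$, from $I\chi_1\land\cdots\land I\chi_n\to I\varphi$ infer $(\neg I^R\chi_1\land I\chi_1)\land\cdots\land(\neg I^R\chi_n\land I\chi_n)\to\neg I^R\varphi$. Theoremhood ($\vdash\varphi$) is as usual, and $\Gamma\vdash\varphi$ means that $\vdash\gamma_1\land\cdots\land\gamma_k\to\varphi$ for some finitely many $\gamma_1,\dots,\gamma_k\in\Gamma$. *)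

theory Defs
  imports Main
begin

text \<open>The nonempty set of propositional variables is the type \<open>'p\<close>.\<close>

datatype 'p fm =
    Var 'p
  | Neg "'p fm"            (\<open>\<^bold>\<not> _\<close> [80] 80)
  | Con "'p fm" "'p fm"    (infixr \<open>\<^bold>\<and>\<close> 75)
  | Ign "'p fm"            (\<open>\<^bold>I _\<close> [80] 80)
  | IgnR "'p fm"           (\<open>\<^bold>I\<^sup>R _\<close> [80] 80)

abbreviation Dis :: "'p fm \<Rightarrow> 'p fm \<Rightarrow> 'p fm" (infixr \<open>\<^bold>\<or>\<close> 70) where
  "\<phi> \<^bold>\<or> \<psi> \<equiv> \<^bold>\<not> (\<^bold>\<not> \<phi> \<^bold>\<and> \<^bold>\<not> \<psi>)"

abbreviation Imp :: "'p fm \<Rightarrow> 'p fm \<Rightarrow> 'p fm" (infixr \<open>\<^bold>\<longrightarrow>\<close> 65) where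
  "\<phi> \<^bold>\<longrightarrow> \<psi> \<equiv> \<^bold>\<not> (\<phi> \<^bold>\<and> \<^bold>\<not> \<psi>)"

abbreviation Iff :: "'p fm \<Rightarrow> 'p fm \<Rightarrow> 'p fm" (infix \<open>\<^bold>\<longleftrightarrow>\<close> 60) where
  "\<phi> \<^bold>\<longleftrightarrow> \<psi> \<equiv> (\<phi> \<^bold>\<longrightarrow> \<psi>) \<^bold>\<and> (\<psi> \<^bold>\<longrightarrow> \<phi>)"

text \<open>Here \<open>undefined\<close> is only an arbitrary but fixed propositional variable.\<close>

definition Bot :: "'p fm" (\<open>\<^bold>\<bottom>\<close>) where
  "\<^bold>\<bottom> = Var undefined \<^bold>\<and> \<^bold>\<not> Var undefined"

definition Top :: "'p fm" (\<open>\<^bold>\<top>\<close>) where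
  "\<^bold>\<top> = \<^bold>\<not> \<^bold>\<bottom>"

fun big_con :: "'p fm list \<Rightarrow> 'p fm" where
  "big_con [] = \<^bold>\<top>"
| "big_con [\<phi>] = \<phi>"
| "big_con (\<phi> # \<psi> # \<chi>s) = \<phi> \<^bold>\<and> big_con (\<psi> # \<chi>s)"

record 's bi_frame =
  states :: "'s set"
  rel :: "('s \<times> 's) set"
  bullet :: "('s \<times> 's) set"

record ('s, 'p) bi_model = "'s bi_frame" +
  val :: "'p \<Rightarrow> 's set"

definition bi_frame :: "'s bi_frame \<Rightarrow> bool" where
  "bi_frame \<FF> \<longleftrightarrow> states \<FF> \<noteq> {} \<and>
     rel \<FF> \<subseteq> states \<FF> \<times> states \<FF> \<and> bullet \<FF> \<subseteq> states \<FF> \<times> states \<FF>"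

definition proper :: "'s bi_frame \<Rightarrow> bool" where
  "proper \<FF> \<longleftrightarrow> rel \<FF> \<subseteq> bullet \<FF>"

definition serial :: "'s bi_frame \<Rightarrow> bool" where
  "serial \<FF> \<longleftrightarrow> (\<forall>s\<in>states \<FF>. \<exists>t\<in>states \<FF>. (s, t) \<in> rel \<FF>) \<and>
     (\<forall>s\<in>states \<FF>. \<exists>t\<in>states \<FF>. (s, t) \<in> bullet \<FF>)"

definition serial_proper_frames :: "'s bi_frame set" where
  "serial_proper_frames = {\<FF>. bi_frame \<FF> \<and> serial \<FF> \<and> proper \<FF>}"

definition bi_model :: "('s, 'p) bi_model \<Rightarrow> bool" where
  "bi_model M \<longleftrightarrow> bi_frame (bi_frame.truncate M) \<and> (\<forall>p. val M p \<subseteq> states M)"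

primrec sat :: "('s, 'p) bi_model \<Rightarrow> 's \<Rightarrow> 'p fm \<Rightarrow> bool" where
  "sat M s (Var p) \<longleftrightarrow> s \<in> val M p"
| "sat M s (\<^bold>\<not> \<phi>) \<longleftrightarrow> \<not> sat M s \<phi>"
| "sat M s (\<phi> \<^bold>\<and> \<psi>) \<longleftrightarrow> sat M s \<phi> \<and> sat M s \<psi>"
| "sat M s (\<^bold>I \<phi>) \<longleftrightarrow>
     (\<exists>t. (s, t) \<in> rel M \<and> sat M t \<phi>) \<and> (\<exists>u. (s, u) \<in> rel M \<and> \<not> sat M u \<phi>)"
| "sat M s (\<^bold>I\<^sup>R \<phi>) \<longleftrightarrow>
     ((\<exists>t. (s, t) \<in> rel M \<and> sat M t \<phi>) \<and> (\<exists>u. (s, u) \<in> rel M \<and> \<not> sat M u \<phi>)) \<and>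
     (\<exists>t. (s, t) \<in> bullet M \<and>
       \<not> ((\<exists>v. (t, v) \<in> rel M \<and> sat M v \<phi>) \<and> (\<exists>u. (t, u) \<in> rel M \<and> \<not> sat M u \<phi>)))"

text \<open>Primitive recursion on the formula makes the last clause spell out the truth
  condition of \<open>\<^bold>I \<phi>\<close>; folded back:\<close>

lemma sat_IgnR:
  "sat M s (\<^bold>I\<^sup>R \<phi>) \<longleftrightarrow> sat M s (\<^bold>I \<phi>) \<and> (\<exists>t. (s, t) \<in> bullet M \<and> \<not> sat M t (\<^bold>I \<phi>))"
  by simp

text \<open>The truncation of a model is its underlying frame. The class \<open>F\<close>, and with it the
  models, is confined to carriers inside the type \<open>'s\<close>, as no formula can quantify over
  all types. The type \<open>'p fm set\<close> is large enough for the canonical model.\<close>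

definition consequence :: "'s bi_frame set \<Rightarrow> 'p fm set \<Rightarrow> 'p fm \<Rightarrow> bool" where
  "consequence F \<Gamma> \<phi> \<longleftrightarrow>
     (\<forall>M :: ('s, 'p) bi_model. bi_model M \<and> bi_frame.truncate M \<in> F \<longrightarrow>
       (\<forall>s\<in>states M. (\<forall>\<gamma>\<in>\<Gamma>. sat M s \<gamma>) \<longrightarrow> sat M s \<phi>))"

text \<open>Instances of propositional tautologies are the formulas true under every Boolean
  valuation of the variables and of the formulas starting with a modality.\<close>

primrec bool_eval :: "('p fm \<Rightarrow> bool) \<Rightarrow> 'p fm \<Rightarrow> bool" where
  "bool_eval v (Var p) \<longleftrightarrow> v (Var p)"
| "bool_eval v (\<^bold>\<not> \<phi>) \<longleftrightarrow> \<not> bool_eval v \<phi>"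
| "bool_eval v (\<phi> \<^bold>\<and> \<psi>) \<longleftrightarrow> bool_eval v \<phi> \<and> bool_eval v \<psi>"
| "bool_eval v (\<^bold>I \<phi>) \<longleftrightarrow> v (\<^bold>I \<phi>)"
| "bool_eval v (\<^bold>I\<^sup>R \<phi>) \<longleftrightarrow> v (\<^bold>I\<^sup>R \<phi>)"

definition tautology :: "'p fm \<Rightarrow> bool" where
  "tautology \<phi> \<longleftrightarrow> (\<forall>v. bool_eval v \<phi>)"

inductive IRIK :: "'p fm \<Rightarrow> bool" (\<open>\<turnstile> _\<close> [50] 50) where
  Taut: "tautology \<phi> \<Longrightarrow> \<turnstile> \<phi>"
| I_Neg: "\<turnstile> (\<^bold>I \<phi> \<^bold>\<longleftrightarrow> \<^bold>I (\<^bold>\<not> \<phi>))"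
| IR_Neg: "\<turnstile> (\<^bold>I\<^sup>R \<phi> \<^bold>\<longleftrightarrow> \<^bold>I\<^sup>R (\<^bold>\<not> \<phi>))"
| I_Con: "\<turnstile> (\<^bold>I (\<phi> \<^bold>\<and> \<psi>) \<^bold>\<longrightarrow> \<^bold>I \<phi> \<^bold>\<or> \<^bold>I \<psi>)"
| I_Dis: "\<turnstile> (\<^bold>I (\<phi> \<^bold>\<or> \<psi>) \<^bold>\<and> \<^bold>I (\<^bold>\<not> \<phi> \<^bold>\<or> \<chi>) \<^bold>\<longrightarrow> \<^bold>I \<phi>)"
| IR_I: "\<turnstile> (\<^bold>I\<^sup>R \<phi> \<^bold>\<longrightarrow> \<^bold>I \<phi>)"
| Mix: "\<turnstile> (\<^bold>I \<phi> \<^bold>\<and> \<^bold>I (\<^bold>I \<phi> \<^bold>\<or> \<chi>) \<^bold>\<longrightarrow> \<^bold>I\<^sup>R \<phi>)"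
| MP: "\<turnstile> (\<phi> \<^bold>\<longrightarrow> \<psi>) \<Longrightarrow> \<turnstile> \<phi> \<Longrightarrow> \<turnstile> \<psi>"
| Nec: "\<turnstile> \<phi> \<Longrightarrow> \<turnstile> \<^bold>\<not> \<^bold>I \<phi>"
| RE_I: "\<turnstile> (\<phi> \<^bold>\<longleftrightarrow> \<psi>) \<Longrightarrow> \<turnstile> (\<^bold>I \<phi> \<^bold>\<longleftrightarrow> \<^bold>I \<psi>)"
| RE_IR: "\<turnstile> (\<phi> \<^bold>\<longleftrightarrow> \<psi>) \<Longrightarrow> \<turnstile> (\<^bold>I\<^sup>R \<phi> \<^bold>\<longleftrightarrow> \<^bold>I\<^sup>R \<psi>)"
| R_IR: "\<turnstile> (big_con (map Ign \<chi>s) \<^bold>\<longrightarrow> \<^bold>I \<phi>) \<Longrightarrow>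
    \<turnstile> (big_con (map (\<lambda>\<chi>. \<^bold>\<not> \<^bold>I\<^sup>R \<chi> \<^bold>\<and> \<^bold>I \<chi>) \<chi>s) \<^bold>\<longrightarrow> \<^bold>\<not> \<^bold>I\<^sup>R \<phi>)"

definition derivable :: "'p fm set \<Rightarrow> 'p fm \<Rightarrow> bool" (infix \<open>\<tturnstile>\<close> 50) where
  "\<Gamma> \<tturnstile> \<phi> \<longleftrightarrow> (\<exists>\<gamma>s. set \<gamma>s \<subseteq> \<Gamma> \<and> \<turnstile> (big_con \<gamma>s \<^bold>\<longrightarrow> \<phi>))"

end

theory Submission
  imports Defs
begin

text \<open>Completeness is by a canonical model. Let \<open>core s\<close> collect the formulas \<open>\<phi>\<close> such that no
  \<open>\<^bold>I (\<phi> \<^bold>\<or> \<psi>)\<close> lies in the maximal consistent set \<open>s\<close>: these are the formulas that \<open>s\<close> makes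
  necessary. It is a filter, and it decides \<open>\<phi>\<close> exactly when \<open>\<^bold>I \<phi> \<notin> s\<close>. So \<open>(s, t) \<in> R\<close> is defined
  by \<open>core s \<subseteq> t\<close>, except that a set without any \<open>\<^bold>I \<phi>\<close>, whose core is inconsistent, sees
  only itself; one successor refutes every \<open>\<^bold>I \<phi>\<close>. The pair \<open>(s, t)\<close> is in the second relation if \<open>t\<close>
  contains \<open>\<^bold>I \<phi>\<close> whenever \<open>s\<close> contains \<open>\<^bold>I \<phi>\<close> but not \<open>\<^bold>I\<^sup>R \<phi>\<close>. The last rule gives the successors
  needed for \<open>\<^bold>I\<^sup>R \<phi>\<close>, and the mixed axiom puts such \<open>\<^bold>I \<phi>\<close> into the core, whence properness.\<close>

section \<open>Evaluation of the constants and of finite conjunctions\<close>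

lemma bool_eval_simps [simp]:
  "\<not> bool_eval v \<^bold>\<bottom>" "bool_eval v \<^bold>\<top>"
  by (auto simp: Bot_def Top_def)

lemma bool_eval_big_con [simp]: "bool_eval v (big_con \<phi>s) \<longleftrightarrow> (\<forall>\<phi>\<in>set \<phi>s. bool_eval v \<phi>)"
  by (induction \<phi>s rule: big_con.induct) auto

lemma sat_simps [simp]: "\<not> sat M s \<^bold>\<bottom>" "sat M s \<^bold>\<top>"
  by (auto simp: Bot_def Top_def)

lemma sat_big_con [simp]: "sat M s (big_con \<phi>s) \<longleftrightarrow> (\<forall>\<phi>\<in>set \<phi>s. sat M s \<phi>)"
  by (induction \<phi>s rule: big_con.induct) auto

section \<open>Soundness\<close>

text \<open>Truth at a state is itself a Boolean valuation of variables and modal formulas, so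
  tautologies hold at every state.\<close>

lemma bool_eval_sat: "bool_eval (sat M s) \<phi> \<longleftrightarrow> sat M s \<phi>"
  by (induction \<phi>) auto

text \<open>The state varies in the induction, since \<open>Nec\<close>, the replacement rules and
  \<open>R_IR\<close> use their premises at states other than \<open>s\<close>.\<close>

lemma IRIK_sound:
  assumes "\<turnstile> \<phi>" "rel M \<subseteq> states M \<times> states M" "bullet M \<subseteq> states M \<times> states M"
    and "rel M \<subseteq> bullet M" "s \<in> states M"
  shows "sat M s \<phi>"
  using assms(1,5)
proof (induction arbitrary: s rule: IRIK.induct)
  case (Taut \<phi>)
  then show ?case
    by (metis bool_eval_sat tautology_def)
next
  \<comment> \<open>The successor refuting the disjunction refutes \<open>Ign \<phi>\<close>, and by
    properness it is also a \<open>bullet\<close>-successor.\<close>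
  case (Mix \<phi> \<chi>)
  then show ?case
    using assms(4) by fastforce
next
  case (Nec \<phi>)
  then show ?case
    using assms(2) by auto
next
  case (RE_I \<phi> \<psi>)
  have "sat M t \<phi> \<longleftrightarrow> sat M t \<psi>" if "(s, t) \<in> rel M" for t
    using RE_I.IH[of t] that assms(2) by auto
  then show ?case
    by auto
next
  case (RE_IR \<phi> \<psi>)
  \<comment> \<open>\<open>IgnR\<close> evaluates \<open>Ign\<close> at
    \<open>bullet\<close>-successors too, so the agreement is needed at the successors of every
    point; the bound \<open>s\<close> is a fresh one.\<close>
  have "sat M t \<phi> \<longleftrightarrow> sat M t \<psi>" if "(s, t) \<in> rel M" for s t
    using RE_IR.IH[of t] that assms(2) by auto
  then have "sat M t (\<^bold>I \<phi>) \<longleftrightarrow> sat M t (\<^bold>I \<psi>)" for t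
    by auto
  then show ?case
    unfolding sat.simps(2,3) sat_IgnR by blast
next
  case (R_IR \<chi>s \<phi>)
  show ?case
  proof (rule ccontr)
    assume "\<not> ?thesis"
    then have prems: "\<forall>\<chi>\<in>set \<chi>s. sat M s (\<^bold>I \<chi>) \<and> \<not> sat M s (\<^bold>I\<^sup>R \<chi>)" and "sat M s (\<^bold>I\<^sup>R \<phi>)"
      by (auto simp del: sat.simps(4,5))
    then obtain t where t: "(s, t) \<in> bullet M" "\<not> sat M t (\<^bold>I \<phi>)"
      unfolding sat_IgnR by blast
    \<comment> \<open>Where \<open>Ign \<chi>\<close> holds and \<open>IgnR \<chi>\<close> fails,
      every \<open>bullet\<close>-successor satisfies \<open>Ign \<chi>\<close>. The premise of the
      rule, read at \<open>t\<close>, then yields \<open>Ign \<phi>\<close> there.\<close>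
    have "\<forall>\<chi>\<in>set \<chi>s. sat M t (\<^bold>I \<chi>)"
      using prems t(1) unfolding sat_IgnR by blast
    moreover have "t \<in> states M"
      using t(1) assms(3) by auto
    ultimately show False
      using R_IR.IH t(2) by (auto simp del: sat.simps(4,5))
  qed
qed ((simp; blast)+)

lemma derivable_sound:
  assumes "\<Gamma> \<tturnstile> \<phi>"
  shows "consequence (serial_proper_frames :: 's bi_frame set) \<Gamma> \<phi>"
  unfolding consequence_def
proof (intro allI impI ballI)
  fix M :: "('s, 'a) bi_model" and s
  assume M: "bi_model M \<and> bi_frame.truncate M \<in> serial_proper_frames"
    and s: "s \<in> states M" and \<Gamma>: "\<forall>\<gamma>\<in>\<Gamma>. sat M s \<gamma>"
  have frame: "rel M \<subseteq> states M \<times> states M" "bullet M \<subseteq> states M \<times> states M" "rel M \<subseteq> bullet M"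
    using M by (auto simp: serial_proper_frames_def bi_frame_def proper_def bi_frame.defs)
  obtain \<gamma>s where "set \<gamma>s \<subseteq> \<Gamma>" "\<turnstile> (big_con \<gamma>s \<^bold>\<longrightarrow> \<phi>)"
    using assms by (auto simp: derivable_def)
  then have "sat M s (big_con \<gamma>s \<^bold>\<longrightarrow> \<phi>)" "sat M s (big_con \<gamma>s)"
    using IRIK_sound[OF _ frame s] \<Gamma> unfolding sat_big_con by blast+
  then show "sat M s \<phi>"
    by simp
qed

section \<open>Derivability and maximal consistent sets\<close>

text \<open>Moving the premises one by one into antecedents leaves a tautology, and modus ponens
  detaches them again. Propositional steps thus reduce to checking Boolean valuations.\<close>

lemma IRIK_taut_closed:
  assumes "\<forall>\<psi>\<in>set \<psi>s. \<turnstile> \<psi>" "\<And>v. \<forall>\<psi>\<in>set \<psi>s. bool_eval v \<psi> \<Longrightarrow> bool_eval v \<phi>"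
  shows "\<turnstile> \<phi>"
  using assms
proof (induction \<psi>s arbitrary: \<phi>)
  case Nil
  then show ?case
    by (simp add: Taut tautology_def)
next
  case (Cons \<psi> \<psi>s)
  have "\<turnstile> (\<psi> \<^bold>\<longrightarrow> \<phi>)"
    using Cons.prems by (intro Cons.IH) auto
  then show ?case
    using Cons.prems(1) MP by auto
qed

lemma derivable_assm: "\<phi> \<in> \<Gamma> \<Longrightarrow> \<Gamma> \<tturnstile> \<phi>"
  unfolding derivable_def by (intro exI[of _ "[\<phi>]"]) (auto intro!: Taut simp: tautology_def)

lemma derivable_theorem: "\<turnstile> \<phi> \<Longrightarrow> \<Gamma> \<tturnstile> \<phi>"
  unfolding derivable_def
  by (intro exI[of _ "[]"] conjI IRIK_taut_closed[of "[\<phi>]"]) auto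

lemma derivable_MP:
  assumes "\<Gamma> \<tturnstile> \<phi> \<^bold>\<longrightarrow> \<psi>" "\<Gamma> \<tturnstile> \<phi>"
  shows "\<Gamma> \<tturnstile> \<psi>"
proof -
  obtain \<gamma>s \<delta>s where "set \<gamma>s \<subseteq> \<Gamma>" "set \<delta>s \<subseteq> \<Gamma>"
    and *: "\<turnstile> (big_con \<gamma>s \<^bold>\<longrightarrow> \<phi> \<^bold>\<longrightarrow> \<psi>)" "\<turnstile> (big_con \<delta>s \<^bold>\<longrightarrow> \<phi>)"
    using assms unfolding derivable_def by blast
  moreover have "\<turnstile> (big_con (\<gamma>s @ \<delta>s) \<^bold>\<longrightarrow> \<psi>)"
    by (rule IRIK_taut_closed[of "[big_con \<gamma>s \<^bold>\<longrightarrow> \<phi> \<^bold>\<longrightarrow> \<psi>, big_con \<delta>s \<^bold>\<longrightarrow> \<phi>]"])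
      (use * in auto)
  ultimately show ?thesis
    unfolding derivable_def by (intro exI[of _ "\<gamma>s @ \<delta>s"]) auto
qed

lemma derivable_taut_closed:
  assumes "\<forall>\<psi>\<in>set \<psi>s. \<Gamma> \<tturnstile> \<psi>" "\<And>v. \<forall>\<psi>\<in>set \<psi>s. bool_eval v \<psi> \<Longrightarrow> bool_eval v \<phi>"
  shows "\<Gamma> \<tturnstile> \<phi>"
  using assms
proof (induction \<psi>s arbitrary: \<phi>)
  case Nil
  then show ?case
    by (simp add: Taut tautology_def derivable_theorem)
next
  case (Cons \<psi> \<psi>s)
  have "\<Gamma> \<tturnstile> \<psi> \<^bold>\<longrightarrow> \<phi>"
    using Cons.prems by (intro Cons.IH) auto
  then show ?case
    using Cons.prems(1) derivable_MP by auto
qed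

text \<open>Deleting every occurrence of \<open>\<phi>\<close> leaves a premise list over
  \<open>\<Gamma>\<close>; the antecedent \<open>\<phi>\<close> restores the deleted
  conjuncts.\<close>

lemma derivable_deduction:
  assumes "insert \<phi> \<Gamma> \<tturnstile> \<psi>"
  shows "\<Gamma> \<tturnstile> \<phi> \<^bold>\<longrightarrow> \<psi>"
proof -
  obtain \<gamma>s where "set \<gamma>s \<subseteq> insert \<phi> \<Gamma>" and *: "\<turnstile> (big_con \<gamma>s \<^bold>\<longrightarrow> \<psi>)"
    using assms unfolding derivable_def by blast
  moreover have "\<turnstile> (big_con (removeAll \<phi> \<gamma>s) \<^bold>\<longrightarrow> \<phi> \<^bold>\<longrightarrow> \<psi>)"
    by (rule IRIK_taut_closed[of "[big_con \<gamma>s \<^bold>\<longrightarrow> \<psi>]"]) (use * in auto)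
  ultimately show ?thesis
    unfolding derivable_def by (intro exI[of _ "removeAll \<phi> \<gamma>s"]) auto
qed

text \<open>Maximality is phrased by one-formula extensions: Zorn's lemma yields this form directly,
  and the deduction theorem turns it into negation completeness.\<close>

definition mcs :: "'p fm set \<Rightarrow> bool" where
  "mcs s \<longleftrightarrow> \<not> s \<tturnstile> \<^bold>\<bottom> \<and> (\<forall>\<phi>. \<phi> \<notin> s \<longrightarrow> insert \<phi> s \<tturnstile> \<^bold>\<bottom>)"

lemma Lindenbaum:
  assumes "\<not> \<Gamma> \<tturnstile> \<^bold>\<bottom>"
  obtains s where "mcs s" "\<Gamma> \<subseteq> s"
proof -
  define A where "A = {\<Delta>. \<Gamma> \<subseteq> \<Delta> \<and> \<not> \<Delta> \<tturnstile> \<^bold>\<bottom>}"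
  have "\<exists>s\<in>A. \<forall>\<Delta>\<in>A. s \<subseteq> \<Delta> \<longrightarrow> \<Delta> = s"
  proof (rule subset_Zorn_nonempty)
    show "A \<noteq> {}"
      using assms by (auto simp: A_def)
    fix C assume C: "C \<noteq> {}" "subset.chain A C"
    \<comment> \<open>A derivation uses finitely many premises, so an inconsistency of the union
      would already occur in one member of the chain.\<close>
    have "\<not> \<Union>C \<tturnstile> \<^bold>\<bottom>"
    proof
      assume "\<Union>C \<tturnstile> \<^bold>\<bottom>"
      then obtain \<gamma>s where "set \<gamma>s \<subseteq> \<Union>C" "\<turnstile> (big_con \<gamma>s \<^bold>\<longrightarrow> \<^bold>\<bottom>)"
        unfolding derivable_def by blast
      moreover from this obtain \<Delta> where "\<Delta> \<in> C" "set \<gamma>s \<subseteq> \<Delta>"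
        using finite_subset_Union_chain[OF _ _ C] by blast
      ultimately show False
        using C(2) unfolding A_def subset_chain_def derivable_def by blast
    qed
    then show "\<Union>C \<in> A"
      using C unfolding A_def subset_chain_def by blast
  qed
  then obtain s where s: "s \<in> A" "\<And>\<Delta>. \<Delta> \<in> A \<Longrightarrow> s \<subseteq> \<Delta> \<Longrightarrow> \<Delta> = s"
    by blast
  have "insert \<phi> s \<tturnstile> \<^bold>\<bottom>" if "\<phi> \<notin> s" for \<phi>
    using s(1) s(2)[of "insert \<phi> s"] that by (auto simp: A_def)
  with s(1) show ?thesis
    by (intro that[of s]) (auto simp: A_def mcs_def)
qed

lemma mcs_derivable:
  assumes "mcs s" "s \<tturnstile> \<phi>"
  shows "\<phi> \<in> s"
proof (rule ccontr)
  assume "\<phi> \<notin> s"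
  then have "s \<tturnstile> \<phi> \<^bold>\<longrightarrow> \<^bold>\<bottom>"
    using assms(1) derivable_deduction by (auto simp: mcs_def)
  then show False
    using assms derivable_MP by (auto simp: mcs_def)
qed

lemma mcs_taut_closed:
  assumes "mcs s" "set \<psi>s \<subseteq> s" "\<And>v. \<forall>\<psi>\<in>set \<psi>s. bool_eval v \<psi> \<Longrightarrow> bool_eval v \<phi>"
  shows "\<phi> \<in> s"
  using assms by (intro mcs_derivable derivable_taut_closed[of \<psi>s]) (auto intro: derivable_assm)

lemma mcs_theorem: "mcs s \<Longrightarrow> \<turnstile> \<phi> \<Longrightarrow> \<phi> \<in> s"
  by (simp add: derivable_theorem mcs_derivable)

lemma mcs_Neg:
  assumes "mcs s"
  shows "\<^bold>\<not> \<phi> \<in> s \<longleftrightarrow> \<phi> \<notin> s"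
proof
  show "\<phi> \<notin> s" if "\<^bold>\<not> \<phi> \<in> s"
  proof
    assume "\<phi> \<in> s"
    then have "\<^bold>\<bottom> \<in> s"
      by (intro mcs_taut_closed[OF assms, of "[\<phi>, \<^bold>\<not> \<phi>]"]) (use that in auto)
    then show False
      using assms derivable_assm by (auto simp: mcs_def)
  qed
  show "\<^bold>\<not> \<phi> \<in> s" if "\<phi> \<notin> s"
  proof -
    have "s \<tturnstile> \<phi> \<^bold>\<longrightarrow> \<^bold>\<bottom>"
      using assms derivable_deduction that by (auto simp: mcs_def)
    then have "s \<tturnstile> \<^bold>\<not> \<phi>"
      by (intro derivable_taut_closed[of "[\<phi> \<^bold>\<longrightarrow> \<^bold>\<bottom>]"]) auto
    then show ?thesis
      by (rule mcs_derivable[OF assms])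
  qed
qed

lemma mcs_Con:
  assumes "mcs s"
  shows "\<phi> \<^bold>\<and> \<psi> \<in> s \<longleftrightarrow> \<phi> \<in> s \<and> \<psi> \<in> s"
proof
  assume *: "\<phi> \<^bold>\<and> \<psi> \<in> s"
  have "\<phi> \<in> s" "\<psi> \<in> s"
    by (rule mcs_taut_closed[OF assms, of "[\<phi> \<^bold>\<and> \<psi>]"]; use * in simp)+
  then show "\<phi> \<in> s \<and> \<psi> \<in> s" ..
next
  assume *: "\<phi> \<in> s \<and> \<psi> \<in> s"
  show "\<phi> \<^bold>\<and> \<psi> \<in> s"
    by (rule mcs_taut_closed[OF assms, of "[\<phi>, \<psi>]"]) (use * in auto)
qed

lemma mcs_Iff:
  assumes "mcs s" "\<turnstile> (\<phi> \<^bold>\<longleftrightarrow> \<psi>)"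
  shows "\<phi> \<in> s \<longleftrightarrow> \<psi> \<in> s"
  using mcs_theorem[OF assms] by (auto simp: mcs_Neg mcs_Con assms(1))

lemma mcs_big_con: "mcs s \<Longrightarrow> set \<phi>s \<subseteq> s \<Longrightarrow> big_con \<phi>s \<in> s"
  by (rule mcs_taut_closed) auto

section \<open>The canonical model\<close>

lemma Ign_cong:
  assumes "mcs s" "\<And>v. bool_eval v \<phi> \<longleftrightarrow> bool_eval v \<psi>"
  shows "\<^bold>I \<phi> \<in> s \<longleftrightarrow> \<^bold>I \<psi> \<in> s"
proof -
  have "\<turnstile> (\<^bold>I \<phi> \<^bold>\<longleftrightarrow> \<^bold>I \<psi>)"
    using assms(2) by (intro RE_I Taut) (simp add: tautology_def)
  then show ?thesis
    by (rule mcs_Iff[OF assms(1)])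
qed

lemma Ign_Neg: "mcs s \<Longrightarrow> \<^bold>I (\<^bold>\<not> \<phi>) \<in> s \<longleftrightarrow> \<^bold>I \<phi> \<in> s"
  using mcs_theorem[OF _ I_Neg, of s \<phi>] by (auto simp: mcs_Neg mcs_Con)

text \<open>Non-contingency of \<open>\<phi>\<close> alone does not tell truth at all successors
  from falsity at all of them. The disjuncts do: if \<open>\<phi>\<close> were false throughout, a
  contingent \<open>\<psi>\<close> would make the disjunction contingent.\<close>

definition core :: "'p fm set \<Rightarrow> 'p fm set" where
  "core s = {\<phi>. \<forall>\<psi>. \<^bold>I (\<phi> \<^bold>\<or> \<psi>) \<notin> s}"

text \<open>A disjunction of \<open>\<psi>\<close> and \<open>\<chi>\<close> absorbs the stronger
  \<open>\<phi>\<close>, so it is itself, up to provable equivalence, a disjunction with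
  \<open>\<phi>\<close>.\<close>

lemma core_weaken:
  assumes "mcs s" "\<phi> \<in> core s" "\<turnstile> (\<phi> \<^bold>\<longrightarrow> \<psi>)"
  shows "\<psi> \<in> core s"
  unfolding core_def
proof (intro CollectI allI)
  fix \<chi>
  have "\<turnstile> (\<phi> \<^bold>\<or> (\<psi> \<^bold>\<or> \<chi>) \<^bold>\<longleftrightarrow> \<psi> \<^bold>\<or> \<chi>)"
    by (rule IRIK_taut_closed[of "[\<phi> \<^bold>\<longrightarrow> \<psi>]"]) (use assms(3) in auto)
  then have "\<^bold>I (\<phi> \<^bold>\<or> (\<psi> \<^bold>\<or> \<chi>)) \<in> s \<longleftrightarrow> \<^bold>I (\<psi> \<^bold>\<or> \<chi>) \<in> s"
    by (intro mcs_Iff[OF assms(1)] RE_I)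
  then show "\<^bold>I (\<psi> \<^bold>\<or> \<chi>) \<notin> s"
    using assms(2) by (auto simp: core_def)
qed

text \<open>Disjunction distributes over the conjunction, and \<open>I_Con\<close> splits the
  result.\<close>

lemma core_Con:
  assumes "mcs s" "\<phi> \<in> core s" "\<psi> \<in> core s"
  shows "\<phi> \<^bold>\<and> \<psi> \<in> core s"
  unfolding core_def
proof (intro CollectI allI)
  fix \<chi>
  have "\<^bold>I (\<phi> \<^bold>\<or> \<chi>) \<notin> s" "\<^bold>I (\<psi> \<^bold>\<or> \<chi>) \<notin> s"
    using assms by (auto simp: core_def)
  then have "\<^bold>I ((\<phi> \<^bold>\<or> \<chi>) \<^bold>\<and> (\<psi> \<^bold>\<or> \<chi>)) \<notin> s"
    using mcs_theorem[OF assms(1) I_Con, of "\<phi> \<^bold>\<or> \<chi>" "\<psi> \<^bold>\<or> \<chi>"]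
    by (auto simp: mcs_Neg mcs_Con assms(1))
  moreover have "\<^bold>I ((\<phi> \<^bold>\<or> \<chi>) \<^bold>\<and> (\<psi> \<^bold>\<or> \<chi>)) \<in> s \<longleftrightarrow> \<^bold>I ((\<phi> \<^bold>\<and> \<psi>) \<^bold>\<or> \<chi>) \<in> s"
    by (rule Ign_cong[OF assms(1)]) auto
  ultimately show "\<^bold>I ((\<phi> \<^bold>\<and> \<psi>) \<^bold>\<or> \<chi>) \<notin> s"
    by blast
qed

lemma core_theorem:
  assumes "mcs s" "\<turnstile> \<phi>"
  shows "\<phi> \<in> core s"
  unfolding core_def
proof (intro CollectI allI)
  fix \<psi>
  have "\<turnstile> (\<phi> \<^bold>\<or> \<psi>)"
    by (rule IRIK_taut_closed[of "[\<phi>]"]) (use assms(2) in auto)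
  then show "\<^bold>I (\<phi> \<^bold>\<or> \<psi>) \<notin> s"
    using mcs_theorem[OF assms(1) Nec] mcs_Neg[OF assms(1)] by blast
qed

lemma core_derivable:
  assumes "mcs s" "core s \<tturnstile> \<phi>"
  shows "\<phi> \<in> core s"
proof -
  obtain \<gamma>s where \<gamma>s: "set \<gamma>s \<subseteq> core s" "\<turnstile> (big_con \<gamma>s \<^bold>\<longrightarrow> \<phi>)"
    using assms(2) unfolding derivable_def by blast
  have "big_con \<gamma>s \<in> core s"
    using \<gamma>s(1)
  proof (induction \<gamma>s rule: big_con.induct)
    case 1
    show ?case
      by (simp add: core_theorem[OF assms(1)] Taut tautology_def)
  qed (auto intro: core_Con[OF assms(1)])
  then show ?thesis
    using core_weaken[OF assms(1)] \<gamma>s(2) by blast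
qed

text \<open>The disjunct in \<open>core\<close> may be \<open>\<phi>\<close> itself.\<close>

lemma core_Ign:
  assumes "mcs s" "\<^bold>I \<phi> \<in> s"
  shows "\<phi> \<notin> core s"
proof -
  have "\<^bold>I (\<phi> \<^bold>\<or> \<phi>) \<in> s \<longleftrightarrow> \<^bold>I \<phi> \<in> s"
    by (rule Ign_cong[OF assms(1)]) auto
  then show ?thesis
    using assms(2) by (auto simp: core_def)
qed

text \<open>If neither were in the core, the two offending disjuncts would be exactly those of
  \<open>I_Dis\<close>.\<close>

lemma core_decides:
  assumes "mcs s" "\<^bold>I \<phi> \<notin> s"
  shows "\<phi> \<in> core s \<or> \<^bold>\<not> \<phi> \<in> core s"
proof (rule ccontr)
  assume "\<not> ?thesis"
  then obtain \<psi> \<chi> where "\<^bold>I (\<phi> \<^bold>\<or> \<psi>) \<in> s" "\<^bold>I (\<^bold>\<not> \<phi> \<^bold>\<or> \<chi>) \<in> s"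
    by (auto simp: core_def)
  then show False
    using mcs_theorem[OF assms(1) I_Dis, of \<phi> \<psi> \<chi>] assms(2)
    by (simp add: mcs_Neg mcs_Con assms(1))
qed

text \<open>Otherwise the core would derive, hence contain, the negation of \<open>\<phi>\<close>,
  whose ignorance is also in \<open>s\<close> by \<open>I_Neg\<close>.\<close>

lemma core_extension:
  assumes "mcs s" "\<^bold>I \<phi> \<in> s"
  obtains t where "mcs t" "core s \<subseteq> t" "\<phi> \<in> t"
proof -
  have "\<not> insert \<phi> (core s) \<tturnstile> \<^bold>\<bottom>"
  proof
    assume "insert \<phi> (core s) \<tturnstile> \<^bold>\<bottom>"
    then have "core s \<tturnstile> \<phi> \<^bold>\<longrightarrow> \<^bold>\<bottom>"
      by (rule derivable_deduction)
    then have "core s \<tturnstile> \<^bold>\<not> \<phi>"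
      by (intro derivable_taut_closed[of "[\<phi> \<^bold>\<longrightarrow> \<^bold>\<bottom>]"]) auto
    then have "\<^bold>\<not> \<phi> \<in> core s"
      by (rule core_derivable[OF assms(1)])
    moreover have "\<^bold>I (\<^bold>\<not> \<phi>) \<in> s"
      using assms by (simp add: Ign_Neg)
    ultimately show False
      using core_Ign assms(1) by blast
  qed
  then show ?thesis
    using Lindenbaum that by (metis insert_subset)
qed

lemma core_Mix:
  assumes "mcs s" "\<^bold>I \<phi> \<in> s" "\<^bold>I\<^sup>R \<phi> \<notin> s"
  shows "\<^bold>I \<phi> \<in> core s"
proof -
  have "\<^bold>I (\<^bold>I \<phi> \<^bold>\<or> \<chi>) \<notin> s" for \<chi>
    using mcs_theorem[OF assms(1) Mix, of \<phi> \<chi>] assms by (simp add: mcs_Neg mcs_Con)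
  then show ?thesis
    by (simp add: core_def)
qed

text \<open>If no such \<open>t\<close> existed, finitely many of the required
  \<open>Ign \<chi>\<close> would imply \<open>Ign \<phi>\<close>. As \<open>s\<close> contains each
  \<open>Ign \<chi>\<close> without \<open>IgnR \<chi>\<close>, \<open>R_IR\<close> would exclude
  \<open>IgnR \<phi>\<close> from \<open>s\<close>.\<close>

lemma IgnR_extension:
  assumes "mcs s" "\<^bold>I\<^sup>R \<phi> \<in> s"
  obtains t where "mcs t" "\<And>\<chi>. \<^bold>I \<chi> \<in> s \<Longrightarrow> \<^bold>I\<^sup>R \<chi> \<notin> s \<Longrightarrow> \<^bold>I \<chi> \<in> t" "\<^bold>I \<phi> \<notin> t"
proof -
  define \<Gamma> where "\<Gamma> = Ign ` {\<chi>. \<^bold>I \<chi> \<in> s \<and> \<^bold>I\<^sup>R \<chi> \<notin> s}"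
  have "\<not> insert (\<^bold>\<not> \<^bold>I \<phi>) \<Gamma> \<tturnstile> \<^bold>\<bottom>"
  proof
    assume "insert (\<^bold>\<not> \<^bold>I \<phi>) \<Gamma> \<tturnstile> \<^bold>\<bottom>"
    then have "\<Gamma> \<tturnstile> \<^bold>\<not> \<^bold>I \<phi> \<^bold>\<longrightarrow> \<^bold>\<bottom>"
      by (rule derivable_deduction)
    then have "\<Gamma> \<tturnstile> \<^bold>I \<phi>"
      by (intro derivable_taut_closed[of "[\<^bold>\<not> \<^bold>I \<phi> \<^bold>\<longrightarrow> \<^bold>\<bottom>]"]) auto
    then obtain \<gamma>s where \<gamma>s: "set \<gamma>s \<subseteq> \<Gamma>" "\<turnstile> (big_con \<gamma>s \<^bold>\<longrightarrow> \<^bold>I \<phi>)"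
      unfolding derivable_def by blast
    \<comment> \<open>\<open>R_IR\<close> expects premises of the form
      \<open>map Ign \<chi>s\<close>, so preimages under \<open>Ign\<close> are chosen entry by
      entry.\<close>
    from \<gamma>s(1) obtain \<chi>s where \<chi>s: "\<gamma>s = map Ign \<chi>s" "set \<chi>s \<subseteq> {\<chi>. \<^bold>I \<chi> \<in> s \<and> \<^bold>I\<^sup>R \<chi> \<notin> s}"
    proof (induction \<gamma>s arbitrary: thesis)
      case (Cons \<gamma> \<gamma>s)
      obtain \<chi>s where "\<gamma>s = map Ign \<chi>s" "set \<chi>s \<subseteq> {\<chi>. \<^bold>I \<chi> \<in> s \<and> \<^bold>I\<^sup>R \<chi> \<notin> s}"
        using Cons by auto
      moreover obtain \<chi> where "\<gamma> = \<^bold>I \<chi>" "\<^bold>I \<chi> \<in> s" "\<^bold>I\<^sup>R \<chi> \<notin> s"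
        using Cons.prems(2) by (auto simp: \<Gamma>_def)
      ultimately show ?case
        by (intro Cons.prems(1)[of "\<chi> # \<chi>s"]) auto
    qed simp
    have "big_con (map (\<lambda>\<chi>. \<^bold>\<not> \<^bold>I\<^sup>R \<chi> \<^bold>\<and> \<^bold>I \<chi>) \<chi>s) \<in> s"
      using \<chi>s(2) by (intro mcs_big_con[OF assms(1)]) (auto simp: mcs_Neg mcs_Con assms(1))
    then show False
      using mcs_theorem[OF assms(1) R_IR[of \<chi>s \<phi>]] \<gamma>s(2) \<chi>s(1) assms
      by (simp add: mcs_Neg mcs_Con)
  qed
  then obtain t where "mcs t" "insert (\<^bold>\<not> \<^bold>I \<phi>) \<Gamma> \<subseteq> t"
    using Lindenbaum by blast
  then show ?thesis
    by (intro that[of t]) (auto simp: \<Gamma>_def mcs_Neg)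
qed

section \<open>The canonical frame\<close>

definition canonical :: "('p fm set, 'p) bi_model" where
  "canonical = \<lparr>states = {s. mcs s},
     rel = {(s, t). mcs s \<and> mcs t \<and> (if \<exists>\<phi>. \<^bold>I \<phi> \<in> s then core s \<subseteq> t else t = s)},
     bullet = {(s, t). mcs s \<and> mcs t \<and> (\<forall>\<phi>. \<^bold>I \<phi> \<in> s \<and> \<^bold>I\<^sup>R \<phi> \<notin> s \<longrightarrow> \<^bold>I \<phi> \<in> t)},
     val = (\<lambda>p. {s. mcs s \<and> Var p \<in> s})\<rparr>"

lemma canonical_simps [simp]:
  "states canonical = {s. mcs s}"
  "(s, t) \<in> rel canonical \<longleftrightarrow>
     mcs s \<and> mcs t \<and> (if \<exists>\<phi>. \<^bold>I \<phi> \<in> s then core s \<subseteq> t else t = s)"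
  "(s, t) \<in> bullet canonical \<longleftrightarrow>
     mcs s \<and> mcs t \<and> (\<forall>\<phi>. \<^bold>I \<phi> \<in> s \<and> \<^bold>I\<^sup>R \<phi> \<notin> s \<longrightarrow> \<^bold>I \<phi> \<in> t)"
  "val canonical p = {s. mcs s \<and> Var p \<in> s}"
  by (auto simp: canonical_def)

lemma canonical_proper: "rel canonical \<subseteq> bullet canonical"
proof (rule subrelI)
  fix s t :: "'p fm set"
  assume "(s, t) \<in> rel canonical"
  \<comment> \<open>If \<open>s\<close> contains some \<open>Ign \<phi>\<close>, the required
    formulas lie in \<open>core s\<close>, hence in \<open>t\<close>; otherwise nothing is required
    of \<open>t\<close>.\<close>
  then show "(s, t) \<in> bullet canonical"
    using core_Mix[of s] by (auto split: if_splits)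
qed

lemma canonical_serial:
  assumes "mcs s"
  shows "\<exists>t. (s, t) \<in> rel canonical"
proof (cases "\<exists>\<phi>. \<^bold>I \<phi> \<in> s")
  case True
  then obtain \<phi> where "\<^bold>I \<phi> \<in> s"
    by blast
  then obtain t where "mcs t" "core s \<subseteq> t"
    using core_extension[OF assms] by blast
  then show ?thesis
    using assms True by (intro exI[of _ t]) simp
next
  case False
  then show ?thesis
    using assms by (intro exI[of _ s]) simp
qed

lemma canonical_frame:
  assumes "mcs (s :: 'p fm set)"
  shows "bi_model (canonical :: ('p fm set, 'p) bi_model)"
    and "bi_frame.truncate (canonical :: ('p fm set, 'p) bi_model) \<in> serial_proper_frames"
proof -
  let ?C = "canonical :: ('p fm set, 'p) bi_model"
  have trunc: "states (bi_frame.truncate ?C) = states ?C" "rel (bi_frame.truncate ?C) = rel ?C"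
    "bullet (bi_frame.truncate ?C) = bullet ?C"
    by (simp_all add: bi_frame.defs)
  \<comment> \<open>The given \<open>s\<close> makes the carrier nonempty.\<close>
  have "bi_frame (bi_frame.truncate ?C)"
    unfolding bi_frame_def trunc using assms by auto
  moreover have "proper (bi_frame.truncate ?C)"
    unfolding proper_def trunc by (rule canonical_proper)
  moreover have "\<exists>t\<in>states ?C. (s, t) \<in> rel ?C" if "s \<in> states ?C" for s
    using canonical_serial[of s] that by auto
  \<comment> \<open>Properness carries seriality from \<open>rel\<close> over to
    \<open>bullet\<close>.\<close>
  then have "serial (bi_frame.truncate ?C)"
    unfolding serial_def trunc using canonical_proper by blast
  ultimately show "bi_model ?C" "bi_frame.truncate ?C \<in> serial_proper_frames"
    by (auto simp: bi_model_def serial_proper_frames_def)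
qed

section \<open>The truth lemma\<close>

lemma truth_Ign:
  assumes "mcs s"
  shows "\<^bold>I \<phi> \<in> s \<longleftrightarrow>
    (\<exists>t. (s, t) \<in> rel canonical \<and> \<phi> \<in> t) \<and> (\<exists>u. (s, u) \<in> rel canonical \<and> \<phi> \<notin> u)"
proof
  assume *: "\<^bold>I \<phi> \<in> s"
  obtain t where t: "mcs t" "core s \<subseteq> t" "\<phi> \<in> t"
    using core_extension[OF assms *] by blast
  have "\<^bold>I (\<^bold>\<not> \<phi>) \<in> s"
    using * by (simp add: Ign_Neg assms)
  then obtain u where "mcs u" "core s \<subseteq> u" "\<^bold>\<not> \<phi> \<in> u"
    using core_extension[OF assms] by blast
  then show "(\<exists>t. (s, t) \<in> rel canonical \<and> \<phi> \<in> t) \<and> (\<exists>u. (s, u) \<in> rel canonical \<and> \<phi> \<notin> u)"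
    using * t assms by (auto simp: mcs_Neg)
next
  assume *: "(\<exists>t. (s, t) \<in> rel canonical \<and> \<phi> \<in> t) \<and> (\<exists>u. (s, u) \<in> rel canonical \<and> \<phi> \<notin> u)"
  show "\<^bold>I \<phi> \<in> s"
  proof (rule ccontr)
    assume "\<^bold>I \<phi> \<notin> s"
    then have "\<phi> \<in> core s \<or> \<^bold>\<not> \<phi> \<in> core s"
      by (rule core_decides[OF assms])
    \<comment> \<open>Either both successors extend the core and so agree on \<open>\<phi>\<close>,
      or both are \<open>s\<close> itself.\<close>
    with * show False
      by (auto simp: mcs_Neg split: if_splits)
  qed
qed

text \<open>From right to left, if \<open>IgnR \<phi>\<close> were missing, the definition of
  \<open>bullet\<close> would force \<open>Ign \<phi>\<close> into \<open>t\<close>.\<close>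

lemma truth_IgnR:
  assumes "mcs s"
  shows "\<^bold>I\<^sup>R \<phi> \<in> s \<longleftrightarrow> \<^bold>I \<phi> \<in> s \<and> (\<exists>t. (s, t) \<in> bullet canonical \<and> \<^bold>I \<phi> \<notin> t)"
proof
  assume *: "\<^bold>I\<^sup>R \<phi> \<in> s"
  then have "\<^bold>I \<phi> \<in> s"
    using mcs_theorem[OF assms IR_I, of \<phi>] by (simp add: mcs_Neg mcs_Con assms)
  moreover obtain t where "mcs t" "\<And>\<chi>. \<^bold>I \<chi> \<in> s \<Longrightarrow> \<^bold>I\<^sup>R \<chi> \<notin> s \<Longrightarrow> \<^bold>I \<chi> \<in> t" "\<^bold>I \<phi> \<notin> t"
    using IgnR_extension[OF assms *] by blast
  ultimately show "\<^bold>I \<phi> \<in> s \<and> (\<exists>t. (s, t) \<in> bullet canonical \<and> \<^bold>I \<phi> \<notin> t)"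
    using assms by auto
qed auto

lemma truth: "mcs s \<Longrightarrow> sat canonical s \<phi> \<longleftrightarrow> \<phi> \<in> s"
proof (induction \<phi> arbitrary: s)
  case (Ign \<phi>)
  have "sat canonical t \<phi> \<longleftrightarrow> \<phi> \<in> t" if "(s, t) \<in> rel canonical" for t
    using Ign.IH that by simp
  then show ?case
    unfolding truth_Ign[OF Ign.prems] sat.simps by blast
next
  case (IgnR \<phi>)
  \<comment> \<open>The induction hypothesis covers only \<open>\<phi>\<close>, as
    \<open>Ign \<phi>\<close> is no immediate subformula of \<open>IgnR \<phi>\<close>. Its truth is
    rebuilt at every maximal consistent set to reach the \<open>bullet\<close>-successors.\<close>
  have I: "sat canonical t (\<^bold>I \<phi>) \<longleftrightarrow> \<^bold>I \<phi> \<in> t" if "mcs t" for t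
  proof -
    have "sat canonical u \<phi> \<longleftrightarrow> \<phi> \<in> u" if "(t, u) \<in> rel canonical" for u
      using IgnR.IH that by simp
    then show ?thesis
      unfolding truth_Ign[OF that] sat.simps by blast
  qed
  have "mcs t" if "(s, t) \<in> bullet canonical" for t
    using that by simp
  then show ?case
    unfolding truth_IgnR[OF IgnR.prems] sat_IgnR using I IgnR.prems by blast
qed (auto simp: mcs_Neg mcs_Con)

section \<open>Completeness, by refuting \<open>\<phi>\<close> at a canonical state containing
  \<open>\<Gamma>\<close>\<close>

lemma completeness:
  fixes \<Gamma> :: "'p fm set"
  assumes "consequence (serial_proper_frames :: 'p fm set bi_frame set) \<Gamma> \<phi>"
  shows "\<Gamma> \<tturnstile> \<phi>"
proof (rule ccontr)
  assume not: "\<not> \<Gamma> \<tturnstile> \<phi>"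
  have "\<not> insert (\<^bold>\<not> \<phi>) \<Gamma> \<tturnstile> \<^bold>\<bottom>"
  proof
    assume "insert (\<^bold>\<not> \<phi>) \<Gamma> \<tturnstile> \<^bold>\<bottom>"
    then have "\<Gamma> \<tturnstile> \<^bold>\<not> \<phi> \<^bold>\<longrightarrow> \<^bold>\<bottom>"
      by (rule derivable_deduction)
    then have "\<Gamma> \<tturnstile> \<phi>"
      by (intro derivable_taut_closed[of "[\<^bold>\<not> \<phi> \<^bold>\<longrightarrow> \<^bold>\<bottom>]"]) auto
    with not show False ..
  qed
  then obtain s where s: "mcs s" "insert (\<^bold>\<not> \<phi>) \<Gamma> \<subseteq> s"
    using Lindenbaum by blast
  then have "\<forall>\<gamma>\<in>\<Gamma>. sat canonical s \<gamma>" "\<not> sat canonical s \<phi>"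
    by (auto simp: truth mcs_Neg)
  then show False
    using assms canonical_frame[OF s(1)] s(1) unfolding consequence_def by auto
qed

text \<open>The canonical model has carrier type \<open>'p fm set\<close>, so consequence over that
  type already yields derivability; the second conjunct gives soundness for any carrier type
  \<open>'s\<close>.\<close>

theorem theorem21:
  fixes \<Gamma> :: "'p fm set" and \<phi> :: "'p fm"
  shows "(\<Gamma> \<tturnstile> \<phi> \<longleftrightarrow> consequence (serial_proper_frames :: 'p fm set bi_frame set) \<Gamma> \<phi>) \<and>
         (\<Gamma> \<tturnstile> \<phi> \<longrightarrow> consequence (serial_proper_frames :: 's bi_frame set) \<Gamma> \<phi>)"
  by (intro conjI impI iffI) (erule derivable_sound completeness)+

end
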